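(* Let $D(V,E)$ be a directed graph and $S\subseteq V$ a target node set. The target controllability problem in the original graph network $D(V,E)$, in its path cover form $$\operatorname{argmin}_{P}\ |P|^+\quad\text{s.t.}\quad |Cover(P\cup\mathcal{C})|=\sum_{k=1}^{|P|}p_k+\sum_{k=1}^{|\mathcal{C}|}c_k,\qquad S\subseteq Cover(P\cup\mathcal{C}),$$ is equivalent to the converted maximum flow problem $maxflow(D^{(N)},cap,v_s,v_t)$.
   Context: Target controllability problem. The network $D(V,E)$ with $V=\{v_1,\dots,v_N\}$ carries the linear time-invariant dynamics $\dot{\mathbf x}=A\mathbf x+B\mathbf u$, $\mathbf y=C\mathbf x$. Here $A$ is the $N\times N$ adjacency matrix of the network, $B$ is an $N\times M$ input matrix describing which nodes are connected to which of $M$ external control sources, and $C$ is the $|S|\times N$ matrix whose rows are the rows of the $N\times N$ identity matrix indexed by the nodes of $S$. The system is target controllable if $\mathrm{rank}[CB, CAB,\dots,CA^{N-1}B]=|S|$. The problem is to find the minimum number $M$ of external control sources for which the target set $S$ is (structurally) controllable. It is converted into the path cover problem displayed in the claim, where the first node of each directed path is connected to a different control source. Path cover notation. $P$ is a set of simple directed paths in $D$, and $p_k$ is the number of vertices of the $k$th path (a single vertex is allowed as a path). $\mathcal{C}$ is a set of simple directed circles in $D$, and $c_k$ is the number of vertices of the $k$th circle. $|P|$ and $|\mathcal{C}|$ are the numbers of paths and circles. $Cover(P\cup\mathcal{C})$ is the set of all vertices lying on some path in $P$ or circle in $\mathcal{C}$. $|P|^+=\max\{|P|,1\}$. The first constraint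 says that each node occurs at most once in $P\cup\mathcal{C}$; the second says that all nodes of $S$ are covered. Converted flow network. $D^{(N)}=(V^{(N)},E^{(N)})$ has vertex set $V^{(N)}=\{v^{in}:v\in V\}\cup\{v^{out}:v\in V\}\cup\{v_s,v_t\}$, where each node $v$ has been split into $v^{in}$ and $v^{out}$, and $v_s$ and $v_t$ are two added nodes. Its edge set is $E^{(N)}=E^{(1)}\cup E^{(2)}\cup E^{(3)}\cup E^{(4)}$, with $E^{(1)}=\{(v_t,v^{out}):v\in S\}$, $E^{(2)}=\{(v^{in},v_s):v\in S\}$, $E^{(3)}=\{(v^{in},v^{out}):v\in V\setminus S\}$, $E^{(4)}=\{(v_i^{out},v_j^{in}):(v_i,v_j)\in E\}$. The capacity function $cap$ assigns capacity $1$ to every edge of $E^{(N)}$. $maxflow(D^{(N)},cap,v_s,v_t)$ denotes the problem of finding a maximum flow from $v_t$ to $v_s$ in this network, i.e. a flow of maximum value among those with $0\le flow(e)\le 1$ on each edge $e$ and inflow equal to outflow at every vertex other than $v_s$ and $v_t$.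
   Formalization: An optimal path set yields a maximum flow on its arcs except when |P| = 1 while circles alone can cover S: there zero paths and one path have the same cost |P|^+ = 1, so the one-path optimum need not give a maximum flow. *)

theory Defs
  imports Complex_Main "Graph_Theory.Graph_Theory"
begin

section \<open>The path cover problem\<close>

text \<open>
  Digraphs are finite, without parallel arcs, and may have self-loops. A path is a nonempty distinct
  vertex list (\<^const>\<open>vpath\<close>), so \<open>p\<^sub>k\<close> is its length. A circle is a nonempty arc list
  (\<^const>\<open>pre_digraph.cycle\<close>, where a self-loop is a circle on one vertex) that visits the tails of
  its arcs once each, so \<open>c\<^sub>k\<close> is again its length. Rotations of a circle are different lists, but
  the disjointness constraint below excludes using two of them.
\<close>

definition cover_verts :: "'v list set \<Rightarrow> ('v \<times> 'v) list set \<Rightarrow> 'v set" where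
  "cover_verts P C = (\<Union>p\<in>P. set p) \<union> (\<Union>c\<in>C. fst ` set c)"

definition cover_arcs :: "'v list set \<Rightarrow> ('v \<times> 'v) list set \<Rightarrow> ('v \<times> 'v) set" where
  "cover_arcs P C = (\<Union>p\<in>P. set (vwalk_arcs p)) \<union> (\<Union>c\<in>C. set c)"

definition path_cover ::
  "'v pair_pre_digraph \<Rightarrow> 'v set \<Rightarrow> 'v list set \<Rightarrow> ('v \<times> 'v) list set \<Rightarrow> bool" where
  "path_cover D S P C \<longleftrightarrow>
     finite P \<and> (\<forall>p\<in>P. vpath p (with_proj D)) \<and>
     finite C \<and> (\<forall>c\<in>C. pre_digraph.cycle (with_proj D) c) \<and>
     card (cover_verts P C) = (\<Sum>p\<in>P. length p) + (\<Sum>c\<in>C. length c) \<and>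
     S \<subseteq> cover_verts P C"

definition num_sources :: "'v list set \<Rightarrow> nat" where
  "num_sources P = max (card P) 1"

text \<open>The minimisation is over \<open>P\<close>; the circles only have to exist.\<close>

definition optimal_paths :: "'v pair_pre_digraph \<Rightarrow> 'v set \<Rightarrow> 'v list set \<Rightarrow> bool" where
  "optimal_paths D S P \<longleftrightarrow> is_arg_min num_sources (\<lambda>P. \<exists>C. path_cover D S P C) P"


section \<open>Maximum flows\<close>

definition is_flow ::
  "'n pair_pre_digraph \<Rightarrow> ('n \<times> 'n \<Rightarrow> real) \<Rightarrow> 'n \<Rightarrow> 'n \<Rightarrow> ('n \<times> 'n \<Rightarrow> real) \<Rightarrow> bool" where
  "is_flow G c src snk f \<longleftrightarrow>
     (\<forall>e\<in>parcs G. 0 \<le> f e \<and> f e \<le> c e) \<and>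
     (\<forall>x\<in>pverts G - {src, snk}.
        (\<Sum>e\<in>in_arcs (with_proj G) x. f e) = (\<Sum>e\<in>out_arcs (with_proj G) x. f e))"

definition flow_value :: "'n pair_pre_digraph \<Rightarrow> 'n \<Rightarrow> ('n \<times> 'n \<Rightarrow> real) \<Rightarrow> real" where
  "flow_value G src f =
     (\<Sum>e\<in>out_arcs (with_proj G) src. f e) - (\<Sum>e\<in>in_arcs (with_proj G) src. f e)"

definition is_maxflow ::
  "'n pair_pre_digraph \<Rightarrow> ('n \<times> 'n \<Rightarrow> real) \<Rightarrow> 'n \<Rightarrow> 'n \<Rightarrow> ('n \<times> 'n \<Rightarrow> real) \<Rightarrow> bool" where
  "is_maxflow G c src snk f \<longleftrightarrow> is_arg_max (flow_value G src) (is_flow G c src snk) f"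

definition integral_on :: "'n pair_pre_digraph \<Rightarrow> ('n \<times> 'n \<Rightarrow> real) \<Rightarrow> bool" where
  "integral_on G f \<longleftrightarrow> (\<forall>e\<in>parcs G. f e \<in> \<int>)"


section \<open>The converted flow network\<close>

text \<open>
  \<open>VT\<close> is \<open>v\<^sub>t\<close> and \<open>VS\<close> is \<open>v\<^sub>s\<close>. Despite the names, \<open>v\<^sub>t\<close> is the source and \<open>v\<^sub>s\<close> the sink of the
  flow.
\<close>

datatype 'v split_vertex = VIn 'v | VOut 'v | VS | VT

definition network :: "'v pair_pre_digraph \<Rightarrow> 'v set \<Rightarrow> 'v split_vertex pair_pre_digraph" where
  "network D S = \<lparr>
     pverts = VIn ` pverts D \<union> VOut ` pverts D \<union> {VS, VT},
     parcs = {(VT, VOut v) | v. v \<in> S}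
           \<union> {(VIn v, VS) | v. v \<in> S}
           \<union> {(VIn v, VOut v) | v. v \<in> pverts D - S}
           \<union> {(VOut u, VIn v) | u v. (u, v) \<in> parcs D} \<rparr>"

definition unit_cap :: "'v split_vertex \<times> 'v split_vertex \<Rightarrow> real" where
  "unit_cap e = 1"

text \<open>The arcs of the original graph that carry positive flow in the converted network.\<close>

definition used_arcs ::
  "'v pair_pre_digraph \<Rightarrow> ('v split_vertex \<times> 'v split_vertex \<Rightarrow> real) \<Rightarrow> ('v \<times> 'v) set" where
  "used_arcs D f = {(u, v) \<in> parcs D. f (VOut u, VIn v) > 0}"

abbreviation network_flow where
  "network_flow D S \<equiv> is_flow (network D S) unit_cap VT VS"

abbreviation network_value where
  "network_value D S \<equiv> flow_value (network D S) VT"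

abbreviation network_maxflow where
  "network_maxflow D S \<equiv> is_maxflow (network D S) unit_cap VT VS"

end

theory Submission
  imports Defs
begin

text \<open>
  An integral flow in the network is the same as a set \<open>M\<close> of arcs of \<open>D\<close> in which every vertex has
  at most one outgoing and at most one incoming arc, and every vertex outside \<open>S\<close> has both or
  neither; its value is the number of vertices of \<open>S\<close> with an outgoing arc. Such an \<open>M\<close> is a
  disjoint union of circles and of paths that start and end in \<open>S\<close>, and the number of paths (counting
  the vertices of \<open>S\<close> not met by \<open>M\<close>) is the number of vertices of \<open>S\<close> without an outgoing arc.
  Conversely, a path cover becomes such a set after its paths are trimmed to run from their first to
  their last vertex in \<open>S\<close>. Fractional flows are handled by the integral flow theorem, applied with
  all capacities outside the support set to zero, so that the support does not grow.
\<close>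

section \<open>Integral flows\<close>

text \<open>\<open>flow_value\<close> is used below as the net outflow at an arbitrary vertex
  \<open>x\<close>. A single sum over all arcs makes its linearity in \<open>f\<close> explicit, and
  a loop at \<open>x\<close> cancels.\<close>

lemma flow_value_conv:
  assumes "finite (parcs G)"
  shows "flow_value G x f = (\<Sum>e\<in>parcs G. f e * (of_bool (fst e = x) - of_bool (snd e = x)))"
proof -
  have "(\<Sum>e\<in>parcs G. f e * of_bool (h e = x)) = sum f {e \<in> parcs G. h e = x}" for h :: "_ \<Rightarrow> 'a"
    using assms by (simp add: sum.inter_filter of_bool_def if_distrib cong: if_cong)
  then show ?thesis
    by (simp add: flow_value_def out_arcs_def in_arcs_def right_diff_distrib sum_subtractf)
qed

lemma flow_value_upd:
  assumes "finite (parcs G)" and "e \<in> parcs G"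
  shows "flow_value G x (f(e := t)) =
    flow_value G x f + (t - f e) * (of_bool (fst e = x) - of_bool (snd e = x))"
  by (simp add: flow_value_conv assms sum.remove[of "parcs G" e] algebra_simps)

text \<open>Arcs with both ends in \<open>R\<close> cancel, so only the arcs crossing the boundary
  of \<open>R\<close> remain: the net flow across a cut.\<close>

lemma sum_flow_value:
  assumes "finite (parcs G)" and "finite R"
  shows "(\<Sum>x\<in>R. flow_value G x f) =
    (\<Sum>e\<in>parcs G. f e * (of_bool (fst e \<in> R) - of_bool (snd e \<in> R)))"
proof -
  have "(\<Sum>x\<in>R. of_bool (y = x)) = (of_bool (y \<in> R) :: real)" for y
    using assms(2) by (simp add: of_bool_def)
  then have "(\<Sum>x\<in>R. f e * (of_bool (fst e = x) - of_bool (snd e = x))) =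
      f e * (of_bool (fst e \<in> R) - of_bool (snd e \<in> R))" for e
    by (simp add: sum_subtractf flip: sum_distrib_left)
  then show ?thesis
    by (simp add: flow_value_conv assms(1) sum.swap[of _ "parcs G" R])
qed

lemma is_flow_iff:
  "is_flow G c src snk f \<longleftrightarrow>
    (\<forall>e\<in>parcs G. 0 \<le> f e \<and> f e \<le> c e) \<and> (\<forall>x\<in>pverts G - {src, snk}. flow_value G x f = 0)"
  unfolding is_flow_def flow_value_def by (metis right_minus_eq)

section \<open>Residual graphs and augmenting paths\<close>

definition residual_arcs :: "'n pair_pre_digraph \<Rightarrow> ('n \<times> 'n \<Rightarrow> real) \<Rightarrow> ('n \<times> 'n \<Rightarrow> real) \<Rightarrow> ('n \<times> 'n) set"
  where "residual_arcs G c g =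
    {(x, y). (x, y) \<in> parcs G \<and> g (x, y) < c (x, y) \<or> (y, x) \<in> parcs G \<and> 0 < g (y, x)}"

lemma Ints_add1_le:
  fixes a b :: real
  assumes "a \<in> \<int>" "b \<in> \<int>" "a < b"
  shows "a + 1 \<le> b"
proof -
  obtain i j where "a = of_int i" "b = of_int j"
    using assms by (auto elim!: Ints_cases)
  then have "of_int (i + 1) \<le> (of_int j :: real)"
    using assms(3) by (subst of_int_le_iff) simp
  then show ?thesis by (simp add: \<open>a = of_int i\<close> \<open>b = of_int j\<close>)
qed

text \<open>Induction augments the rest of the path first. The clause that \<open>g'\<close> differs
  from \<open>g\<close> only between vertices of the path ensures that the arcs between the new head
  and its successor are still unchanged, so the residual arc there can be used.\<close>

lemma augment_along_path:
  assumes "finite (parcs G)" and "integral_on G c" and "integral_on G g"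
    and "\<forall>e\<in>parcs G. 0 \<le> g e \<and> g e \<le> c e"
    and "xs \<noteq> []" and "distinct xs" and "set (vwalk_arcs xs) \<subseteq> residual_arcs G c g"
  shows "\<exists>g'. integral_on G g' \<and> (\<forall>e\<in>parcs G. 0 \<le> g' e \<and> g' e \<le> c e) \<and>
    (\<forall>e. g' e \<noteq> g e \<longrightarrow> fst e \<in> set xs \<and> snd e \<in> set xs) \<and>
    (\<forall>x. flow_value G x g' = flow_value G x g + of_bool (x = hd xs) - of_bool (x = last xs))"
  using assms(5-7)
proof (induction xs rule: vwalk_arcs.induct)
  case (2 x)
  then show ?case
    using assms(3,4) by (intro exI[of _ g]) auto
next
  case (3 x y ys)
  then obtain g' where g': "integral_on G g'" "\<forall>e\<in>parcs G. 0 \<le> g' e \<and> g' e \<le> c e"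
    "\<And>e. g' e \<noteq> g e \<Longrightarrow> fst e \<in> set (y # ys) \<and> snd e \<in> set (y # ys)"
    "\<And>z. flow_value G z g' = flow_value G z g + of_bool (z = y) - of_bool (z = last (y # ys))"
    by auto
  have neq: "x \<noteq> y" and xnotin: "x \<notin> set (y # ys)"
    using 3 by auto
  have same: "g' (x, y) = g (x, y)" "g' (y, x) = g (y, x)"
    using g'(3)[of "(x, y)"] g'(3)[of "(y, x)"] xnotin by auto
  \<comment> \<open>The change \<open>s\<close> is 1 on a forward arc and -1 on a reversed one;
    either way the net outflow rises by one at \<open>x\<close> and drops by one at
    \<open>y\<close>. Integrality turns positive slack into slack of a full unit.\<close>
  have "\<exists>e s. e \<in> parcs G \<and> e \<in> {(x, y), (y, x)} \<and> s \<in> \<int> \<and> 0 \<le> g e + s \<and> g e + s \<le> c e \<and>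
      (\<forall>z. s * (of_bool (fst e = z) - of_bool (snd e = z)) = of_bool (z = x) - of_bool (z = y))"
  proof -
    consider (fwd) "(x, y) \<in> parcs G" "g (x, y) < c (x, y)" | (bwd) "(y, x) \<in> parcs G" "0 < g (y, x)"
      using 3 by (auto simp: residual_arcs_def)
    then show ?thesis
    proof cases
      case fwd
      then have "g (x, y) + 1 \<le> c (x, y)"
        using assms(2,3) by (intro Ints_add1_le) (auto simp: integral_on_def)
      with fwd assms(4) show ?thesis
        by (intro exI[of _ "(x, y)"] exI[of _ 1]) (auto simp: add_nonneg_nonneg)
    next
      case bwd
      then have "0 + 1 \<le> g (y, x)"
        using assms(3) by (intro Ints_add1_le) (auto simp: integral_on_def)
      with bwd assms(4) show ?thesis
        by (intro exI[of _ "(y, x)"] exI[of _ "-1"]) force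
    qed
  qed
  then obtain e s where e: "e \<in> parcs G" "e \<in> {(x, y), (y, x)}" "s \<in> \<int>" "0 \<le> g e + s" "g e + s \<le> c e"
      "\<And>z. s * (of_bool (fst e = z) - of_bool (snd e = z)) = of_bool (z = x) - of_bool (z = y)"
    by blast
  have ge: "g' e = g e"
    using e(2) same by auto
  show ?case
  proof (intro exI[of _ "g'(e := g e + s)"] conjI allI impI)
    show "integral_on G (g'(e := g e + s))"
      using g'(1) e(1,3) assms(3) by (auto simp: integral_on_def)
    show "\<forall>a\<in>parcs G. 0 \<le> (g'(e := g e + s)) a \<and> (g'(e := g e + s)) a \<le> c a"
      using g'(2) e(4,5) by auto
    show "fst a \<in> set (x # y # ys)" "snd a \<in> set (x # y # ys)"
      if "(g'(e := g e + s)) a \<noteq> g a" for a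
      using that g'(3)[of a] e(2) by (auto split: if_splits)
    show "flow_value G z (g'(e := g e + s)) =
        flow_value G z g + of_bool (z = hd (x # y # ys)) - of_bool (z = last (x # y # ys))" for z
      using g'(4)[of z] e(6)[of z] by (simp add: flow_value_upd[OF assms(1) e(1)] ge)
  qed
qed simp

text \<open>The cut argument of Ford and Fulkerson: if \<open>snk\<close> were unreachable in the
  residual graph, the reachable set would be a cut saturated by \<open>g\<close>, and no flow could
  have a larger value than \<open>g\<close>.\<close>

lemma augment_flow:
  assumes "pair_fin_digraph G" and "src \<in> pverts G" and "snk \<in> pverts G" and "src \<noteq> snk"
    and "integral_on G c" and g: "is_flow G c src snk g" "integral_on G g"
    and f: "is_flow G c src snk f" and less: "flow_value G src g < flow_value G src f"
  shows "\<exists>g'. is_flow G c src snk g' \<and> integral_on G g' \<and> flow_value G src g' = flow_value G src g + 1"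
proof -
  interpret G: pair_fin_digraph G by fact
  define H where "H = \<lparr>pverts = pverts G, parcs = residual_arcs G c g\<rparr>"
  have "pair_wf_digraph H"
    using G.wellformed' by unfold_locales (auto simp: H_def residual_arcs_def)
  then interpret H: pair_wf_digraph H .
  note fin = G.pair_finite_arcs
  define R where "R = {x. src \<rightarrow>\<^sup>*\<^bsub>with_proj H\<^esub> x}"
  have "R \<subseteq> pverts G"
    using H.reachable_in_verts(2) by (auto simp: R_def H_def)
  then have "finite R"
    using G.pair_finite_verts finite_subset by blast
  have "src \<in> pverts H"
    using assms(2) by (simp add: H_def)
  then have "src \<in> R"
    by (simp add: R_def)
  have closed: "y \<in> R" if "x \<in> R" "(x, y) \<in> residual_arcs G c g" for x y
    using that H.reachable_adj_trans[of src x y] by (auto simp: R_def H_def)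
  have "snk \<in> R"
  proof (rule ccontr)
    assume "snk \<notin> R"
    have value_R: "(\<Sum>x\<in>R. flow_value G x h) = flow_value G src h" if "is_flow G c src snk h" for h
    proof -
      have "(\<Sum>x\<in>R. flow_value G x h) = flow_value G src h + (\<Sum>x\<in>R - {src}. flow_value G x h)"
        by (rule sum.remove) fact+
      also have "(\<Sum>x\<in>R - {src}. flow_value G x h) = 0"
        using that \<open>snk \<notin> R\<close> \<open>R \<subseteq> pverts G\<close> by (intro sum.neutral) (auto simp: is_flow_iff)
      finally show ?thesis by simp
    qed
    \<comment> \<open>Since \<open>R\<close> is closed under residual arcs, \<open>g\<close> fills
      every arc leaving \<open>R\<close> and vanishes on every arc entering
      \<open>R\<close>.\<close>
    have "f e * (of_bool (fst e \<in> R) - of_bool (snd e \<in> R)) \<le>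
        g e * (of_bool (fst e \<in> R) - of_bool (snd e \<in> R))" if "e \<in> parcs G" for e
    proof -
      obtain x y where [simp]: "e = (x, y)" by force
      have bounds: "0 \<le> f e" "f e \<le> c e" "0 \<le> g e" "g e \<le> c e"
        using that f g(1) by (auto simp: is_flow_iff)
      consider "x \<in> R \<longleftrightarrow> y \<in> R" | "x \<in> R" "y \<notin> R" | "x \<notin> R" "y \<in> R" by blast
      then show ?thesis
      proof cases
        case 2
        then have "\<not> g e < c e"
          using closed[of x y] that by (auto simp: residual_arcs_def)
        with 2 bounds show ?thesis by simp
      next
        case 3
        then have "\<not> 0 < g e"
          using closed[of y x] that by (auto simp: residual_arcs_def)
        with 3 bounds show ?thesis by simp
      qed auto
    qed
    then have "(\<Sum>x\<in>R. flow_value G x f) \<le> (\<Sum>x\<in>R. flow_value G x g)"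
      by (simp add: sum_flow_value[OF fin \<open>finite R\<close>] sum_mono)
    with less value_R[OF f] value_R[OF g(1)] show False by simp
  qed
  then obtain p where p: "vpath p (with_proj H)" "hd p = src" "last p = snk"
    by (auto simp: R_def H.reachable_vpath_conv)
  then have "p \<noteq> []" "distinct p" "set (vwalk_arcs p) \<subseteq> residual_arcs G c g"
    by (auto simp: vpath_def vwalk_def H_def)
  from augment_along_path[OF fin assms(5) g(2) _ this] g(1)
  obtain g' where g': "integral_on G g'" "\<forall>e\<in>parcs G. 0 \<le> g' e \<and> g' e \<le> c e"
    "\<And>x. flow_value G x g' = flow_value G x g + of_bool (x = src) - of_bool (x = snk)"
    by (auto simp: is_flow_iff p)
  then show ?thesis
    using g(1) \<open>src \<noteq> snk\<close> by (intro exI[of _ g']) (auto simp: is_flow_iff)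
qed

lemma integral_flow_exists:
  assumes "pair_fin_digraph G" and "src \<in> pverts G" and "snk \<in> pverts G" and "src \<noteq> snk"
    and "integral_on G c" and f: "is_flow G c src snk f"
  shows "\<exists>g. is_flow G c src snk g \<and> integral_on G g \<and> flow_value G src f \<le> flow_value G src g"
proof -
  \<comment> \<open>The number \<open>n\<close> counts unit augmentations; the minimum stops the
    growth once the value of \<open>f\<close> is reached.\<close>
  have *: "\<exists>g. is_flow G c src snk g \<and> integral_on G g \<and>
      min (flow_value G src f) (real n) \<le> flow_value G src g" for n
  proof (induction n)
    case 0
    \<comment> \<open>The zero flow respects the capacities because \<open>f\<close> does, which
      makes \<open>c\<close> nonnegative on every arc.\<close>
    have "is_flow G c src snk (\<lambda>_. 0)"
      using f by (force simp: is_flow_iff flow_value_def)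
    then show ?case
      by (intro exI[of _ "\<lambda>_. 0"]) (auto simp: integral_on_def flow_value_def)
  next
    case (Suc n)
    then obtain g where g: "is_flow G c src snk g" "integral_on G g"
      "min (flow_value G src f) (real n) \<le> flow_value G src g" by blast
    show ?case
    proof (cases "flow_value G src g < flow_value G src f")
      case True
      from augment_flow[OF assms(1-5) g(1,2) f True] g(3) True show ?thesis
        by force
    next
      case False
      with g show ?thesis by force
    qed
  qed
  obtain n :: nat where "flow_value G src f \<le> real n"
    using real_arch_simple by blast
  with *[of n] show ?thesis by (simp add: min_def)
qed

text \<open>Control of the support is what lets a fractional maximum flow produce a path cover whose
  arcs all carry flow.\<close>

lemma integral_flow_in_support:
  assumes "pair_fin_digraph G" and "src \<in> pverts G" and "snk \<in> pverts G" and "src \<noteq> snk"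
    and "integral_on G c" and f: "is_flow G c src snk f"
  shows "\<exists>g. is_flow G c src snk g \<and> integral_on G g \<and> (\<forall>e\<in>parcs G. 0 < g e \<longrightarrow> 0 < f e) \<and>
    flow_value G src f \<le> flow_value G src g"
proof -
  define c' where "c' e = (if 0 < f e then c e else 0)" for e
  have "integral_on G c'"
    using assms(5) by (auto simp: integral_on_def c'_def)
  moreover have "is_flow G c' src snk f"
    using f by (force simp: is_flow_iff c'_def)
  ultimately obtain g where g: "is_flow G c' src snk g" "integral_on G g"
      "flow_value G src f \<le> flow_value G src g"
    using integral_flow_exists[OF assms(1-4)] by blast
  have "0 < f e \<and> g e \<le> c e \<or> g e = 0 \<and> 0 \<le> c e" if "e \<in> parcs G" for e
    using that g(1) f by (force simp: is_flow_iff c'_def split: if_splits)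
  with g show ?thesis
    by (intro exI[of _ g]) (fastforce simp: is_flow_iff)
qed

section \<open>Integral flows in the converted network\<close>

text \<open>A matching between the out-copies and the in-copies of the vertices. The last equation
  is flow conservation outside \<open>S\<close>, where the arc from \<open>VIn v\<close> to
  \<open>VOut v\<close> is the only way out of the former and the only way into the latter.\<close>

definition balanced_matching :: "'v pair_pre_digraph \<Rightarrow> 'v set \<Rightarrow> ('v \<times> 'v) set \<Rightarrow> bool" where
  "balanced_matching D S M \<longleftrightarrow>
    M \<subseteq> parcs D \<and> single_valued M \<and> single_valued (M\<inverse>) \<and> Domain M - S = Range M - S"

lemma pverts_network [simp]:
  "pverts (network D S) = VIn ` pverts D \<union> VOut ` pverts D \<union> {VS, VT}"
  by (simp add: network_def)

lemma parcs_network: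
  "parcs (network D S) = (\<lambda>v. (VT, VOut v)) ` S \<union> (\<lambda>v. (VIn v, VS)) ` S \<union>
    (\<lambda>v. (VIn v, VOut v)) ` (pverts D - S) \<union> (\<lambda>(u, v). (VOut u, VIn v)) ` parcs D"
  by (auto simp: network_def)

lemma pair_fin_digraph_network:
  assumes "pair_fin_digraph D" and "S \<subseteq> pverts D"
  shows "pair_fin_digraph (network D S)"
proof -
  interpret pair_fin_digraph D by fact
  have "finite S"
    using assms(2) pair_finite_verts finite_subset by blast
  then show ?thesis
    using assms(2) pair_finite_verts pair_finite_arcs
    by unfold_locales (auto simp: parcs_network dest: wellformed')
qed

text \<open>Each \<open>VOut u\<close> has exactly one entering arc and each \<open>VIn v\<close>
  exactly one leaving arc, with the other end depending on membership in \<open>S\<close>. These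
  arcs are the bottlenecks that limit the flow through a vertex to one unit.\<close>

lemma flow_value_network:
  shows "network_value D S f = (\<Sum>v\<in>S. f (VT, VOut v))"
    and "u \<in> pverts D \<Longrightarrow> flow_value (network D S) (VOut u) f =
      (\<Sum>v\<in>parcs D `` {u}. f (VOut u, VIn v)) - f (if u \<in> S then VT else VIn u, VOut u)"
    and "v \<in> pverts D \<Longrightarrow> flow_value (network D S) (VIn v) f =
      f (VIn v, if v \<in> S then VS else VOut v) - (\<Sum>u\<in>(parcs D)\<inverse> `` {v}. f (VOut u, VIn v))"
proof -
  have "out_arcs (with_proj (network D S)) VT = (\<lambda>v. (VT, VOut v)) ` S"
    "in_arcs (with_proj (network D S)) VT = {}"
    by (auto simp: parcs_network)
  then show "network_value D S f = (\<Sum>v\<in>S. f (VT, VOut v))"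
    by (simp add: flow_value_def sum.reindex inj_on_def)
  show "flow_value (network D S) (VOut u) f =
      (\<Sum>v\<in>parcs D `` {u}. f (VOut u, VIn v)) - f (if u \<in> S then VT else VIn u, VOut u)"
    if "u \<in> pverts D"
  proof -
    have "out_arcs (with_proj (network D S)) (VOut u) = (\<lambda>v. (VOut u, VIn v)) ` (parcs D `` {u})"
      "in_arcs (with_proj (network D S)) (VOut u) = {(if u \<in> S then VT else VIn u, VOut u)}"
      using that by (auto simp: parcs_network)
    then show ?thesis
      by (simp add: flow_value_def sum.reindex inj_on_def)
  qed
  show "flow_value (network D S) (VIn v) f =
      f (VIn v, if v \<in> S then VS else VOut v) - (\<Sum>u\<in>(parcs D)\<inverse> `` {v}. f (VOut u, VIn v))"
    if "v \<in> pverts D"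
  proof -
    have "in_arcs (with_proj (network D S)) (VIn v) = (\<lambda>u. (VOut u, VIn v)) ` ((parcs D)\<inverse> `` {v})"
      "out_arcs (with_proj (network D S)) (VIn v) = {(VIn v, if v \<in> S then VS else VOut v)}"
      using that by (auto simp: parcs_network)
    then show ?thesis
      by (simp add: flow_value_def sum.reindex inj_on_def)
  qed
qed

lemma sum_of_bool_single_valued:
  assumes "finite (E `` {u})" and "single_valued M" and "M \<subseteq> E"
  shows "(\<Sum>v\<in>E `` {u}. of_bool ((u, v) \<in> M)) = (of_bool (u \<in> Domain M) :: real)"
proof (cases "u \<in> Domain M")
  case True
  then obtain v where v: "(u, v) \<in> M" by blast
  then have "{v \<in> E `` {u}. (u, v) \<in> M} = {v}"
    using assms(2,3) by (auto dest: single_valuedD)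
  then show ?thesis
    using True assms(1) by (simp add: of_bool_def flip: sum.inter_filter)
next
  case False
  then show ?thesis by (auto intro!: sum.neutral)
qed

lemma single_valued_if_sum_of_bool_le_1:
  assumes "finite A" and "(\<Sum>v\<in>A. of_bool ((u, v) \<in> M)) \<le> (1 :: real)"
    and "v \<in> A" "w \<in> A" "(u, v) \<in> M" "(u, w) \<in> M"
  shows "v = w"
proof -
  have "real (card {v \<in> A. (u, v) \<in> M}) \<le> 1"
    using assms(1,2) by (simp add: of_bool_def flip: sum.inter_filter)
  then have "card {v \<in> A. (u, v) \<in> M} \<le> Suc 0" by simp
  then show ?thesis
    using assms by (auto simp: card_le_Suc0_iff_eq)
qed

lemma flow_of_matching:
  assumes D: "pair_fin_digraph D" and S: "S \<subseteq> pverts D" and M: "balanced_matching D S M"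
  shows "\<exists>f. network_flow D S f \<and> integral_on (network D S) f \<and> used_arcs D f = M \<and>
    network_value D S f = real (card (S \<inter> Domain M))"
proof -
  interpret pair_fin_digraph D by fact
  \<comment> \<open>One unit runs along each arc of \<open>M\<close>; conservation dictates the
    other values. The pattern \<open>(_, VOut v)\<close> serves both \<open>VT\<close> and
    \<open>VIn v\<close> as starting points, and for \<open>VIn v\<close> the balance of
    \<open>M\<close> outside \<open>S\<close> makes the value consistent.\<close>
  define f :: "'a split_vertex \<times> 'a split_vertex \<Rightarrow> real" where "f e = (case e of
      (VOut u, VIn v) \<Rightarrow> of_bool ((u, v) \<in> M) | (VIn v, VS) \<Rightarrow> of_bool (v \<in> Range M) |
      (_, VOut v) \<Rightarrow> of_bool (v \<in> Domain M) | _ \<Rightarrow> 0)" for e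
  have finS: "finite S"
    using S pair_finite_verts finite_subset by blast
  have fin: "finite (parcs D `` {u})" "finite ((parcs D)\<inverse> `` {u})" for u
    using pair_finite_arcs by auto
  have M': "M \<subseteq> parcs D" "single_valued M" "single_valued (M\<inverse>)" "v \<notin> S \<Longrightarrow> v \<in> Domain M \<longleftrightarrow> v \<in> Range M" for v
    using M by (auto simp: balanced_matching_def)
  have "\<forall>e. f e \<in> {0, 1}"
    by (auto simp: f_def split: split_vertex.split)
  then have range: "0 \<le> f e" "f e \<le> 1" "f e \<in> \<int>" for e
    by (metis insertE order.refl singletonD zero_le_one, metis insertE order.refl singletonD zero_le_one,
        metis Ints_0 Ints_1 insertE singletonD)
  have rows: "(\<Sum>v\<in>parcs D `` {u}. of_bool ((u, v) \<in> M)) = (of_bool (u \<in> Domain M) :: real)"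
    and cols: "(\<Sum>v\<in>(parcs D)\<inverse> `` {u}. of_bool ((v, u) \<in> M)) = (of_bool (u \<in> Range M) :: real)" for u
    using sum_of_bool_single_valued[OF fin(1) M'(2,1), of u]
      sum_of_bool_single_valued[OF fin(2) M'(3), of u] M'(1)
    by (simp_all only: converse_iff Domain_converse converse_mono)
  have "flow_value (network D S) (VOut u) f = 0" "flow_value (network D S) (VIn u) f = 0"
    if "u \<in> pverts D" for u
    using that M'(4) by (simp_all add: flow_value_network f_def rows cols)
  then have "network_flow D S f"
    by (auto simp: is_flow_iff range unit_cap_def)
  moreover have "used_arcs D f = M"
    using M'(1) by (auto simp: used_arcs_def f_def)
  moreover have "network_value D S f = real (card (S \<inter> Domain M))"
    using finS by (simp add: flow_value_network f_def of_bool_def Int_def flip: sum.inter_filter)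
  ultimately show ?thesis
    using range by (auto simp: integral_on_def)
qed

text \<open>An integral flow under unit capacities is the indicator of its support, and the single
  bottleneck arc at each copy of a vertex leaves room for at most one used arc there.\<close>

lemma matching_of_flow:
  assumes D: "pair_fin_digraph D" and S: "S \<subseteq> pverts D"
    and f: "network_flow D S f" "integral_on (network D S) f"
  shows "balanced_matching D S (used_arcs D f)"
    and "network_value D S f = real (card (S \<inter> Domain (used_arcs D f)))"
proof -
  interpret pair_fin_digraph D by fact
  define M where "M = used_arcs D f"
  have MD: "M \<subseteq> parcs D"
    by (auto simp: M_def used_arcs_def)
  have finS: "finite S"
    using S pair_finite_verts finite_subset by blast
  have fin: "finite (parcs D `` {u})" "finite ((parcs D)\<inverse> `` {u})" for u
    using pair_finite_arcs by auto
  have arcs: "(if u \<in> S then VT else VIn u, VOut u) \<in> parcs (network D S)"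
      "(VIn u, if u \<in> S then VS else VOut u) \<in> parcs (network D S)" if "u \<in> pverts D" for u
    using that by (auto simp: parcs_network)
  have range: "f e \<le> 1" "f e = of_bool (0 < f e)" if "e \<in> parcs (network D S)" for e
  proof -
    have "f e \<in> \<int>"
      using f(2) that by (simp add: integral_on_def)
    then obtain k where "f e = of_int k"
      by (rule Ints_cases)
    moreover have "0 \<le> f e" "f e \<le> 1"
      using f(1) that by (auto simp: is_flow_iff unit_cap_def)
    ultimately show "f e \<le> 1" "f e = of_bool (0 < f e)"
      by (auto simp: of_bool_def)
  qed
  have fM: "f (VOut u, VIn v) = of_bool ((u, v) \<in> M)" if "(u, v) \<in> parcs D" for u v
  proof -
    have "(VOut u, VIn v) \<in> parcs (network D S)"
      using that by (simp add: network_def)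
    from range(2)[OF this] that show ?thesis
      by (simp add: M_def used_arcs_def)
  qed
  have "flow_value (network D S) (VOut u) f = 0" "flow_value (network D S) (VIn u) f = 0"
    if "u \<in> pverts D" for u
    using f(1) that by (auto simp: is_flow_iff)
  then have out: "(\<Sum>v\<in>parcs D `` {u}. of_bool ((u, v) \<in> M)) = f (if u \<in> S then VT else VIn u, VOut u)"
    and inn: "(\<Sum>v\<in>(parcs D)\<inverse> `` {u}. of_bool ((u, v) \<in> M\<inverse>)) = f (VIn u, if u \<in> S then VS else VOut u)"
    if "u \<in> pverts D" for u
    using that by (simp_all add: flow_value_network fM cong: sum.cong_simp)
  have sv: "single_valued M"
  proof (rule single_valuedI)
    fix u v w assume uv: "(u, v) \<in> M" "(u, w) \<in> M"
    then have "u \<in> pverts D" using MD wellformed' by auto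
    with uv MD show "v = w"
      using single_valued_if_sum_of_bool_le_1[OF fin(1)[of u], of u M v w] out[of u] range(1)[OF arcs(1)[of u]]
      by auto
  qed
  have sv': "single_valued (M\<inverse>)"
  proof (rule single_valuedI)
    fix u v w assume uv: "(u, v) \<in> M\<inverse>" "(u, w) \<in> M\<inverse>"
    then have "u \<in> pverts D" using MD wellformed' by auto
    with uv MD show "v = w"
      using single_valued_if_sum_of_bool_le_1[OF fin(2)[of u], of u "M\<inverse>" v w] inn[of u] range(1)[OF arcs(2)[of u]]
      by auto
  qed
  have f_out: "f (if u \<in> S then VT else VIn u, VOut u) = of_bool (u \<in> Domain M)" if "u \<in> pverts D" for u
    unfolding out[OF that, symmetric] by (rule sum_of_bool_single_valued[OF fin(1) sv MD])
  have f_in: "f (VIn u, if u \<in> S then VS else VOut u) = of_bool (u \<in> Range M)" if "u \<in> pverts D" for u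
    using sum_of_bool_single_valued[OF fin(2) sv', of u] MD
    by (simp only: inn[OF that] converse_mono Domain_converse)
  \<comment> \<open>Outside \<open>S\<close> the arcs in \<open>f_out\<close> and
    \<open>f_in\<close> are both \<open>(VIn u, VOut u)\<close>, so the two indicators are the same
    flow value.\<close>
  have "u \<in> Domain M \<longleftrightarrow> u \<in> Range M" if "u \<in> pverts D" "u \<notin> S" for u
    using f_out[OF that(1)] f_in[OF that(1)] that(2) by (simp add: of_bool_eq_iff)
  moreover have "Field M \<subseteq> pverts D"
    using MD wellformed' by (auto simp: Field_def)
  ultimately have "Domain M - S = Range M - S"
    unfolding Field_def by blast
  with MD sv sv' show "balanced_matching D S (used_arcs D f)"
    by (simp add: balanced_matching_def M_def)
  have "network_value D S f = (\<Sum>v\<in>S. of_bool (v \<in> Domain M))"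
    unfolding flow_value_network(1)
  proof (rule sum.cong)
    show "f (VT, VOut v) = of_bool (v \<in> Domain M)" if "v \<in> S" for v
      using f_out[of v] that S by (simp add: subset_iff)
  qed simp
  then show "network_value D S f = real (card (S \<inter> Domain (used_arcs D f)))"
    using finS by (simp add: of_bool_def Int_def M_def flip: sum.inter_filter)
qed

section \<open>Decomposition into paths and circles\<close>

lemma pcas_append: "pcas u (a @ b) w \<longleftrightarrow> (\<exists>x. pcas u a x \<and> pcas x b w)"
  by (induction a arbitrary: u) auto

lemma pcas_imp_rtrancl: "pcas u c w \<Longrightarrow> (u, w) \<in> (set c)\<^sup>*"
proof (induction c arbitrary: u)
  case (Cons e c)
  then have "(snd e, w) \<in> (set (e # c))\<^sup>*"
    by (auto intro: rtrancl_mono[THEN subsetD, of "set c"])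
  moreover have "(u, snd e) \<in> set (e # c)"
    using Cons.prems by auto
  ultimately show ?case
    by (rule converse_rtrancl_into_rtrancl[rotated])
qed simp

lemma pcas_tails_heads: "pcas u c w \<Longrightarrow> map fst c @ [w] = u # map snd c"
  by (induction c arbitrary: u) auto

lemma pawalk_verts_conv: "pcas u c w \<Longrightarrow> pawalk_verts u c = u # map snd c"
  by (induction c arbitrary: u) auto

context pair_wf_digraph
begin

lemma cycle_iff:
  "cycle c \<longleftrightarrow> c \<noteq> [] \<and> set c \<subseteq> parcs G \<and> distinct (map snd c) \<and> (\<exists>u. pcas u c u)"
proof -
  have "u \<in> pverts G" if "c \<noteq> []" "set c \<subseteq> parcs G" "pcas u c u" for u
    using that by (cases c) (auto dest: wellformed'(1))
  moreover have "pcas u c u \<Longrightarrow> distinct (tl (pawalk_verts u c)) \<longleftrightarrow> distinct (map snd c)" for u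
    by (simp add: pawalk_verts_conv)
  ultimately show ?thesis
    unfolding cycle_def awalk_def by metis
qed

text \<open>On a closed walk the list of tails is a rotation of the list of heads, so the two agree
  as multisets.\<close>

lemma cycle_heads:
  assumes "cycle c"
  shows "distinct (map fst c)" and "distinct (map snd c)" and "snd ` set c = fst ` set c"
proof -
  obtain u where u: "pcas u c u" and d: "distinct (map snd c)"
    using assms by (auto simp: cycle_iff)
  have "mset (map fst c) = mset (map snd c)"
    using arg_cong[OF pcas_tails_heads[OF u], of mset] by simp
  then show "distinct (map fst c)" "distinct (map snd c)" "snd ` set c = fst ` set c"
    using d mset_eq_imp_distinct_iff mset_eq_setD by (metis, metis, metis set_map)
qed

text \<open>From \<open>y\<close> the rest of the circle leads to the base point, and the part
  before the arc leads on to \<open>x\<close>.\<close>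

lemma cycle_arc_back:
  assumes "cycle c" and "(x, y) \<in> set c"
  shows "(y, x) \<in> (set c)\<^sup>*"
proof -
  obtain u where u: "pcas u c u"
    using assms by (auto simp: cycle_iff)
  obtain a b where c: "c = a @ (x, y) # b"
    using assms(2) by (meson split_list)
  then have "pcas u a x" "pcas y b u"
    using u by (auto simp: pcas_append)
  then have "(y, u) \<in> (set b)\<^sup>*" "(u, x) \<in> (set a)\<^sup>*"
    by (auto intro: pcas_imp_rtrancl)
  moreover have "(set b)\<^sup>* \<subseteq> (set c)\<^sup>*" "(set a)\<^sup>* \<subseteq> (set c)\<^sup>*"
    by (auto simp: c intro!: rtrancl_mono)
  ultimately show ?thesis by (meson rtrancl_trans subsetD)
qed

end

section \<open>Arc sets of vertex lists\<close>

lemma vwalk_arcs_hd_rtrancl: "w \<in> set p \<Longrightarrow> (hd p, w) \<in> (set (vwalk_arcs p))\<^sup>*"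
proof (induction p rule: vwalk_arcs.induct)
  case (3 x y xs)
  show ?case
  proof (cases "w = x")
    case False
    then have "(y, w) \<in> (set (vwalk_arcs (x # y # xs)))\<^sup>*"
      using 3 by (auto intro: rtrancl_mono[THEN subsetD, of "set (vwalk_arcs (y # xs))"])
    moreover have "(x, y) \<in> set (vwalk_arcs (x # y # xs))"
      by simp
    ultimately show ?thesis
      by (simp only: list.sel converse_rtrancl_into_rtrancl)
  qed simp
qed auto

text \<open>Splitting \<open>p\<close> at \<open>u\<close> puts \<open>w\<close> before or after it,
  and the earlier vertex reaches the later one along the list.\<close>

lemma vwalk_arcs_trancl_total:
  assumes "u \<in> set p" and "w \<in> set p" and "u \<noteq> w"
  shows "(u, w) \<in> (set (vwalk_arcs p))\<^sup>+ \<or> (w, u) \<in> (set (vwalk_arcs p))\<^sup>+"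
proof -
  have *: "(x, y) \<in> (set (vwalk_arcs p))\<^sup>+" if p: "p = a @ x # b" and "y \<in> set b" for x y a b
  proof -
    have "(x, y) \<in> (set (vwalk_arcs (x # b)))\<^sup>+"
    proof (cases b)
      case (Cons z b')
      have "(z, y) \<in> (set (vwalk_arcs b))\<^sup>*"
        using vwalk_arcs_hd_rtrancl[OF \<open>y \<in> set b\<close>] Cons by simp
      then have "(z, y) \<in> (set (vwalk_arcs (x # b)))\<^sup>*"
        using rtrancl_mono[of "set (vwalk_arcs b)" "set (vwalk_arcs (x # b))"] Cons by auto
      moreover have "(x, z) \<in> set (vwalk_arcs (x # b))"
        using Cons by simp
      ultimately show ?thesis
        by (rule rtrancl_into_trancl2[rotated])
    qed (use that in simp)
    then show ?thesis
      using trancl_mono set_vwalk_arcs_append2 p by metis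
  qed
  obtain a b where p: "p = a @ u # b"
    using assms(1) by (meson split_list)
  then consider "w \<in> set b" | a1 a2 where "a = a1 @ w # a2"
    using assms by (auto dest: split_list)
  then show ?thesis
    using *[of a u b w] *[of _ w _ u] p by cases auto
qed

lemma vwalk_arcs_neq_last: "u \<in> set p \<Longrightarrow> u \<noteq> last p \<Longrightarrow> u \<in> fst ` set (vwalk_arcs p)"
  by (induction p rule: vwalk_arcs.induct) auto

lemma vwalk_arcs_neq_hd: "u \<in> set p \<Longrightarrow> u \<noteq> hd p \<Longrightarrow> u \<in> snd ` set (vwalk_arcs p)"
  by (induction p rule: vwalk_arcs.induct) auto

lemma map_fst_vwalk_arcs: "map fst (vwalk_arcs p) = butlast p"
  by (induction p rule: vwalk_arcs.induct) auto

lemma map_snd_vwalk_arcs: "map snd (vwalk_arcs p) = tl p"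
  by (induction p rule: vwalk_arcs.induct) auto

lemma single_valued_set:
  "distinct (map fst l) \<Longrightarrow> single_valued (set l)"
  "distinct (map snd l) \<Longrightarrow> single_valued ((set l)\<inverse>)"
  by (fastforce simp: single_valued_def distinct_map inj_on_def)+

lemma single_valued_vwalk_arcs:
  assumes "distinct p"
  shows "single_valued (set (vwalk_arcs p))" and "single_valued ((set (vwalk_arcs p))\<inverse>)"
  using assms
  by (auto intro!: single_valued_set simp: map_fst_vwalk_arcs map_snd_vwalk_arcs distinct_butlast distinct_tl)

section \<open>Disjointness of the paths and circles of a cover\<close>

text \<open>The union bound with \<open>A i\<close> and \<open>A j\<close> merged must still reach
  the full sum, which leaves no room for an overlap. Bounds \<open>n i\<close> appear because the
  constraint in \<open>path_cover\<close> counts list lengths.\<close>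

lemma card_UN_eq_sum_imp_disjoint:
  assumes "finite I" and "\<And>i. i \<in> I \<Longrightarrow> finite (A i)" and "\<And>i. i \<in> I \<Longrightarrow> card (A i) \<le> n i"
    and eq: "card (\<Union>i\<in>I. A i) = (\<Sum>i\<in>I. n i)" and ij: "i \<in> I" "j \<in> I" "i \<noteq> j"
  shows "A i \<inter> A j = {}"
proof -
  have "(\<Sum>i\<in>I. n i) = card (A i \<union> A j \<union> (\<Union>k\<in>I - {i, j}. A k))"
    using ij by (subst eq[symmetric], intro arg_cong[of _ _ card]) auto
  also have "\<dots> \<le> card (A i \<union> A j) + card (\<Union>k\<in>I - {i, j}. A k)"
    by (rule card_Un_le)
  also have "\<dots> \<le> card (A i \<union> A j) + (\<Sum>k\<in>I - {i, j}. card (A k))"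
    using assms(1) by (intro add_left_mono card_UN_le) auto
  also have "\<dots> \<le> card (A i \<union> A j) + (\<Sum>k\<in>I - {i, j}. n k)"
    by (intro add_left_mono sum_mono assms) auto
  finally have "(\<Sum>i\<in>I. n i) \<le> card (A i \<union> A j) + (\<Sum>k\<in>I - {i, j}. n k)" .
  moreover have "(\<Sum>i\<in>I. n i) = n i + (n j + (\<Sum>k\<in>I - {i} - {j}. n k))"
    using assms(1) ij by (simp add: sum.remove[of I i] sum.remove[of "I - {i}" j])
  moreover have "I - {i} - {j} = I - {i, j}" by auto
  ultimately have "n i + n j \<le> card (A i \<union> A j)" by simp
  moreover have "card (A i) + card (A j) = card (A i \<union> A j) + card (A i \<inter> A j)"
    using assms(2) ij by (intro card_Un_Int) auto
  moreover have "card (A i) \<le> n i" "card (A j) \<le> n j"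
    using assms(3) ij by auto
  ultimately have "card (A i \<inter> A j) = 0" by linarith
  then show ?thesis
    using assms(2) ij by auto
qed

text \<open>The sum type indexes paths and circles together, so that one counting argument separates
  any two pieces of a cover.\<close>

definition piece_verts :: "'v list + ('v \<times> 'v) list \<Rightarrow> 'v set" where
  "piece_verts = case_sum set (\<lambda>c. fst ` set c)"

lemma piece_verts_simps [simp]:
  "piece_verts (Inl p) = set p" "piece_verts (Inr c) = fst ` set c"
  by (simp_all add: piece_verts_def)

lemma piece_verts_disjoint:
  assumes cover: "path_cover D S P C" and ij: "i \<in> P <+> C" "j \<in> P <+> C" "i \<noteq> j"
  shows "piece_verts i \<inter> piece_verts j = {}"
proof -
  have fin: "finite P" "finite C"
    using cover by (auto simp: path_cover_def)
  have "(\<Union>i\<in>P <+> C. piece_verts i) = cover_verts P C"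
    by (auto simp: cover_verts_def Plus_def)
  moreover have "(\<Sum>i\<in>P <+> C. case_sum length length i) = (\<Sum>p\<in>P. length p) + (\<Sum>c\<in>C. length c)"
    using fin by (simp add: sum.Plus o_def)
  ultimately have "card (\<Union>i\<in>P <+> C. piece_verts i) = (\<Sum>i\<in>P <+> C. case_sum length length i)"
    using cover by (simp add: path_cover_def)
  moreover have "card (piece_verts i) \<le> case_sum length length i" "finite (piece_verts i)" for i :: "'a list + ('a \<times> 'a) list"
    by (cases i; simp add: card_length flip: set_map; metis card_length length_map)+
  ultimately show ?thesis
    using fin ij card_UN_eq_sum_imp_disjoint[of "P <+> C" piece_verts "case_sum length length" i j] by auto
qed

lemma path_cover_disjoint:
  assumes "path_cover D S P C"
  shows "p \<in> P \<Longrightarrow> q \<in> P \<Longrightarrow> p \<noteq> q \<Longrightarrow> set p \<inter> set q = {}"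
    and "p \<in> P \<Longrightarrow> c \<in> C \<Longrightarrow> set p \<inter> fst ` set c = {}"
  using piece_verts_disjoint[OF assms, of "Inl p" "Inl q"]
    piece_verts_disjoint[OF assms, of "Inl p" "Inr c"] by auto

lemma pcas_vwalk_arcs: "p \<noteq> [] \<Longrightarrow> pcas (hd p) (vwalk_arcs p) (last p)"
  by (induction p rule: vwalk_arcs.induct) auto

context pair_fin_digraph
begin

lemma matching_decomposition:
  assumes "M \<subseteq> parcs G" and "Field M \<subseteq> W" and "W \<subseteq> pverts G"
    and "single_valued M" and "single_valued (M\<inverse>)"
  shows "\<exists>P C. path_cover G W P C \<and> cover_verts P C = W \<and> cover_arcs P C = M \<and>
    card P + card M = card W"
proof -
  have finW: "finite W"
    using assms(3) pair_finite_verts finite_subset by blast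
  have "finite M"
    using assms(1) pair_finite_arcs finite_subset by blast
  then show ?thesis
    using assms
    \<comment> \<open>A new arc \<open>(u, v)\<close> links the path ending in \<open>u\<close> to the path starting in \<open>v\<close>, or closes that
        path to a circle if the two coincide.\<close>
  proof (induction M)
    \<comment> \<open>Every vertex of \<open>W\<close> starts as a path of its own. Each inserted
      arc then lowers the number of paths by one, which preserves
      \<open>card P + card M\<close>.\<close>
    case empty
    let ?P = "(\<lambda>v. [v]) ` W"
    have "card ?P = card W"
      by (simp add: card_image inj_on_def)
    then show ?case
      using finW empty
      by (intro exI[of _ ?P] exI[of _ "{}"])
        (auto simp: path_cover_def cover_verts_def cover_arcs_def vpath_def sum.reindex inj_on_def)
  next
    case (insert e M)
    obtain u v where e: "e = (u, v)" by force
    have sv: "single_valued M" "single_valued (M\<inverse>)"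
      using insert.prems(4,5) single_valued_subset[of M "insert e M"]
        single_valued_subset[of "M\<inverse>" "(insert e M)\<inverse>"] by auto
    have "Field M \<subseteq> W"
      using insert.prems(2) by (auto simp: Field_def)
    with insert sv obtain P C where PC: "path_cover G W P C" "cover_verts P C = W"
        "cover_arcs P C = M" "card P + card M = card W"
      by auto
    have u: "u \<notin> Domain M"
      using insert.prems(4) insert.hyps(2) by (auto simp: e single_valued_def)
    have v: "v \<notin> Range M"
      using insert.prems(5) insert.hyps(2) by (auto simp: e single_valued_def)
    have uvW: "u \<in> W" "v \<in> W" and arc: "(u, v) \<in> parcs G"
      using insert.prems by (auto simp: e Field_def)
    have fin: "finite P" "finite C"
      and paths: "\<And>p. p \<in> P \<Longrightarrow> distinct p \<and> p \<noteq> [] \<and> set p \<subseteq> pverts G \<and> set (vwalk_arcs p) \<subseteq> parcs G"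
      and cycles: "\<And>c. c \<in> C \<Longrightarrow> cycle c"
      and cardW: "card W = (\<Sum>p\<in>P. length p) + (\<Sum>c\<in>C. length c)"
      using PC by (auto simp: path_cover_def vpath_def vwalk_def)
    note disj = path_cover_disjoint[OF PC(1)]
    \<comment> \<open>A vertex on a circle already has an outgoing and an incoming arc in
      \<open>M\<close>. Hence \<open>u\<close>, with no outgoing arc, and \<open>v\<close>, with no
      incoming arc, both lie on paths.\<close>
    have arcs_C: "fst ` set c \<subseteq> Domain M" "fst ` set c \<subseteq> Range M" if "c \<in> C" for c
    proof -
      have "set c \<subseteq> M"
        using that unfolding PC(3)[symmetric] cover_arcs_def by blast
      then show "fst ` set c \<subseteq> Domain M"
        unfolding Domain_fst by (rule image_mono)
      show "fst ` set c \<subseteq> Range M"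
        unfolding Range_snd cycle_heads(3)[OF cycles[OF that], symmetric]
        using \<open>set c \<subseteq> M\<close> by (rule image_mono)
    qed
    have "u \<notin> fst ` set c" "v \<notin> fst ` set c" if "c \<in> C" for c
      using u v arcs_C[OF that] by blast+
    then obtain p q where p: "p \<in> P" "u \<in> set p" and q: "q \<in> P" "v \<in> set q"
      using uvW PC(2) unfolding cover_verts_def by blast
    have arcs_M: "set (vwalk_arcs p') \<subseteq> M" if "p' \<in> P" for p'
      using that PC(3) unfolding cover_arcs_def by blast
    have lastp: "last p = u"
      using vwalk_arcs_neq_last[OF p(2)] u arcs_M[OF p(1)] by (auto simp: Domain_fst)
    have hdq: "hd q = v"
      using vwalk_arcs_neq_hd[OF q(2)] v arcs_M[OF q(1)] by (auto simp: Range_snd)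
    show ?case
    proof (cases "p = q")
      case False
      define Q where "Q = P - {p, q}"
      have P: "P = insert p (insert q Q)" and Q: "finite Q" "p \<notin> Q" "q \<notin> Q"
        using p(1) q(1) fin(1) by (auto simp: Q_def)
      \<comment> \<open>A member of \<open>Q\<close> equal to \<open>p @ q\<close> would share
        \<open>u\<close> with \<open>p\<close>. That the list is new keeps the counts exact.\<close>
      have new: "p @ q \<notin> Q"
        using disj(1)[of "p @ q" p] p by (auto simp: Q_def)
      have arcs: "set (vwalk_arcs (p @ q)) = insert e (set (vwalk_arcs p) \<union> set (vwalk_arcs q))"
        using paths[OF p(1)] paths[OF q(1)] by (simp add: vwalk_arcs_append lastp hdq e)
      have verts': "cover_verts (insert (p @ q) Q) C = W"
        using PC(2) unfolding P cover_verts_def by auto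
      have arcs': "cover_arcs (insert (p @ q) Q) C = insert e M"
        using PC(3) unfolding P cover_arcs_def by (simp add: arcs Un_ac)
      have "vpath (p @ q) (with_proj G)"
        using paths[OF p(1)] paths[OF q(1)] disj(1)[OF p(1) q(1) False] arcs arc
        by (auto simp: vpath_def vwalk_def e)
      then have "path_cover G W (insert (p @ q) Q) C"
        using PC(1,2) new Q False verts' unfolding path_cover_def by (auto simp: P)
      moreover have "card (insert (p @ q) Q) + card (insert e M) = card W"
        using PC(4) new Q False insert.hyps by (simp add: P)
      ultimately show ?thesis
        using verts' arcs' by blast
    next
      case True
      define Q where "Q = P - {p}"
      \<comment> \<open>Repeating the first vertex at the end adds the closing arc; a one-vertex
        path becomes a self-loop.\<close>
      let ?c = "vwalk_arcs (p @ [hd p])"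
      have P: "P = insert p Q" and Q: "finite Q" "p \<notin> Q"
        using p(1) fin(1) by (auto simp: Q_def)
      have p': "distinct p" "p \<noteq> []" "set p \<subseteq> pverts G" "set (vwalk_arcs p) \<subseteq> parcs G"
        using paths[OF p(1)] by auto
      have closing: "map fst ?c = p" "distinct (map snd ?c)" "pcas (hd p) ?c (hd p)"
        using p'(1,2) pcas_vwalk_arcs[of "p @ [hd p]"]
        by (cases p; simp add: map_fst_vwalk_arcs map_snd_vwalk_arcs del: vwalk_arcs_Cons)+
      have arcs: "set ?c = insert e (set (vwalk_arcs p))"
        using p' hdq True lastp by (simp add: vwalk_arcs_append e)
      have "?c \<noteq> []"
        using arcs by auto
      then have "cycle ?c"
        using closing p'(4) arcs arc insert.prems(1) unfolding cycle_iff by blast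
      have tails: "fst ` set ?c = set p"
        using arg_cong[OF closing(1), of set] by simp
      have len: "length ?c = length p"
        using arg_cong[OF closing(1), of length] by simp
      have new: "?c \<notin> C"
        using disj(2)[OF p(1), of ?c] tails p'(2) by auto
      have verts': "cover_verts Q (insert ?c C) = W"
        using PC(2) unfolding P cover_verts_def by (simp only: UN_insert tails Un_ac)
      have arcs': "cover_arcs Q (insert ?c C) = insert e M"
        using PC(3) unfolding P cover_arcs_def by (simp only: UN_insert arcs) blast
      have "path_cover G W Q (insert ?c C)"
        using PC(1,2) new Q verts' \<open>cycle ?c\<close> len unfolding path_cover_def
        by (simp add: P)
      moreover have "card Q + card (insert e M) = card W"
        using PC(4) Q insert.hyps by (simp add: P)
      ultimately show ?thesis
        using verts' arcs' by blast
    qed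
  qed
qed

end

section \<open>Path covers and matchings\<close>

lemma single_valued_UN:
  assumes "\<And>i. i \<in> I \<Longrightarrow> single_valued (r i)"
    and "\<And>i j. i \<in> I \<Longrightarrow> j \<in> I \<Longrightarrow> i \<noteq> j \<Longrightarrow> Domain (r i) \<inter> Domain (r j) = {}"
  shows "single_valued (\<Union>i\<in>I. r i)"
proof (rule single_valuedI)
  fix x y z assume "(x, y) \<in> (\<Union>i\<in>I. r i)" "(x, z) \<in> (\<Union>i\<in>I. r i)"
  then obtain i j where ij: "i \<in> I" "j \<in> I" "(x, y) \<in> r i" "(x, z) \<in> r j" by auto
  then have "i = j" using assms(2)[of i j] by blast
  with ij assms(1) show "y = z" by (metis single_valuedD)
qed

context pair_wf_digraph
begin

text \<open>Each piece alone has in- and out-degrees at most one, and arcs of different pieces have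
  no vertex in common.\<close>

lemma cover_arcs_matching:
  assumes cover: "path_cover G S P C"
  shows "cover_arcs P C \<subseteq> parcs G" and "single_valued (cover_arcs P C)"
    and "single_valued ((cover_arcs P C)\<inverse>)"
proof -
  have paths: "distinct p" "set (vwalk_arcs p) \<subseteq> parcs G" if "p \<in> P" for p
    using cover that by (auto simp: path_cover_def vpath_def vwalk_def)
  have cycles: "cycle c" if "c \<in> C" for c
    using cover that by (auto simp: path_cover_def)
  then show "cover_arcs P C \<subseteq> parcs G"
    using paths unfolding cover_arcs_def cycle_iff by blast
  define r where "r = case_sum (\<lambda>p. set (vwalk_arcs p)) (set :: ('a \<times> 'a) list \<Rightarrow> _)"
  have cover_r: "cover_arcs P C = (\<Union>i\<in>P <+> C. r i)"
    by (auto simp: cover_arcs_def r_def Plus_def)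
  have dom: "Domain (r i) \<subseteq> piece_verts i" "Range (r i) \<subseteq> piece_verts i" if "i \<in> P <+> C" for i
  proof -
    have "Domain (r i) \<subseteq> piece_verts i \<and> Range (r i) \<subseteq> piece_verts i"
    proof (cases i)
      case (Inl p)
      then show ?thesis
        by (auto simp: r_def  elim: in_set_vwalk_arcsE)
    next
      case (Inr c)
      then have "cycle c"
        using that cycles by auto
      from cycle_heads(3)[OF this] show ?thesis
        by (simp add: Inr r_def  Domain_fst Range_snd)
    qed
    then show "Domain (r i) \<subseteq> piece_verts i" "Range (r i) \<subseteq> piece_verts i" by auto
  qed
  have sv: "single_valued (r i)" "single_valued ((r i)\<inverse>)" if "i \<in> P <+> C" for i
  proof -
    have "single_valued (r i) \<and> single_valued ((r i)\<inverse>)"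
    proof (cases i)
      case (Inl p)
      then show ?thesis
        using that single_valued_vwalk_arcs paths(1) by (auto simp: r_def)
    next
      case (Inr c)
      then have "cycle c"
        using that cycles by auto
      then show ?thesis
        by (simp add: Inr r_def single_valued_set cycle_heads)
    qed
    then show "single_valued (r i)" "single_valued ((r i)\<inverse>)" by auto
  qed
  have disj: "Domain (r i) \<inter> Domain (r j) = {}" "Domain ((r i)\<inverse>) \<inter> Domain ((r j)\<inverse>) = {}"
    if "i \<in> P <+> C" "j \<in> P <+> C" "i \<noteq> j" for i j
    using piece_verts_disjoint[OF cover that] dom[OF that(1)] dom[OF that(2)] unfolding Domain_converse by blast+
  show "single_valued (cover_arcs P C)" "single_valued ((cover_arcs P C)\<inverse>)"
    unfolding cover_r converse_UNION by (intro single_valued_UN sv disj; assumption)+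
qed

lemma cover_imp_matching:
  assumes cover: "path_cover G S P C"
  shows "\<exists>M. balanced_matching G S M \<and> M \<subseteq> cover_arcs P C \<and> card (S - Domain M) \<le> card P"
proof -
  define A where "A = cover_arcs P C"
  note A = cover_arcs_matching[OF cover, folded A_def]
  define M where "M = {(u, v) \<in> A. (\<exists>s\<in>S. (s, u) \<in> A\<^sup>*) \<and> (\<exists>t\<in>S. (v, t) \<in> A\<^sup>*)}"
  \<comment> \<open>This trims each path to the part between its first and last vertex in \<open>S\<close>, and keeps a circle
      if it meets \<open>S\<close>.\<close>
  have "M \<subseteq> A"
    by (auto simp: M_def)
  have "single_valued M" "single_valued (M\<inverse>)"
    using A(2,3) single_valued_subset[of M A] single_valued_subset[of "M\<inverse>" "A\<inverse>"] \<open>M \<subseteq> A\<close> by auto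
  \<comment> \<open>As \<open>u\<close> is outside \<open>S\<close>, the walk from \<open>s\<close>
    to \<open>u\<close> is nonempty. Its last arc belongs to \<open>M\<close>, witnessed by the same
    \<open>s\<close> and \<open>t\<close>.\<close>
  moreover have "u \<in> Range M" if u: "u \<in> Domain M" "u \<notin> S" for u
  proof -
    obtain v s t where *: "(u, v) \<in> A" "s \<in> S" "(s, u) \<in> A\<^sup>*" "t \<in> S" "(v, t) \<in> A\<^sup>*"
      using u(1) unfolding M_def by blast
    then obtain w where "(s, w) \<in> A\<^sup>*" "(w, u) \<in> A"
      using u(2) by (metis rtranclE)
    with * have "(w, u) \<in> M"
      unfolding M_def by (blast intro: converse_rtrancl_into_rtrancl)
    then show ?thesis by blast
  qed
  moreover have "v \<in> Domain M" if v: "v \<in> Range M" "v \<notin> S" for v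
  proof -
    obtain u s t where *: "(u, v) \<in> A" "s \<in> S" "(s, u) \<in> A\<^sup>*" "t \<in> S" "(v, t) \<in> A\<^sup>*"
      using v(1) unfolding M_def by blast
    then obtain w where "(v, w) \<in> A" "(w, t) \<in> A\<^sup>*"
      using v(2) by (metis converse_rtranclE)
    with * have "(v, w) \<in> M"
      unfolding M_def by (blast intro: rtrancl_into_rtrancl)
    then show ?thesis by blast
  qed
  ultimately have "balanced_matching G S M"
    using A(1) \<open>M \<subseteq> A\<close> by (auto simp: balanced_matching_def)
  \<comment> \<open>Consequently a vertex of \<open>S\<close> without an outgoing arc in
    \<open>M\<close> cannot reach any vertex of \<open>S\<close>, itself included, by a nonempty
    walk in \<open>A\<close>.\<close>
  have in_M: "u \<in> Domain M" if uw: "u \<in> S" "w \<in> S" "(u, w) \<in> A\<^sup>+" for u w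
  proof -
    obtain v where "(u, v) \<in> A" "(v, w) \<in> A\<^sup>*"
      using uw(3) by (meson tranclD)
    then show ?thesis
      using uw by (auto simp: M_def)
  qed
  have "card (S - Domain M) \<le> card P"
  \<comment> \<open>Each such vertex is charged to a path through it. On a circle it would reach
    itself, and of two on the same path one would reach the other.\<close>
  proof (rule card_le_if_inj_on_rel[where r = "\<lambda>u p. u \<in> set p"])
    show "finite P"
      using cover by (simp add: path_cover_def)
    show "\<exists>p. p \<in> P \<and> u \<in> set p" if u: "u \<in> S - Domain M" for u
    proof (rule ccontr)
      assume "\<nexists>p. p \<in> P \<and> u \<in> set p"
      moreover have "u \<in> cover_verts P C"
        using u cover by (auto simp: path_cover_def)
      ultimately obtain c v where c: "c \<in> C" "(u, v) \<in> set c"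
        by (auto simp: cover_verts_def)
      then have "set c \<subseteq> A" "cycle c"
        using cover by (auto simp: A_def cover_arcs_def path_cover_def)
      then have "(u, v) \<in> A" "(v, u) \<in> A\<^sup>*"
        using c cycle_arc_back rtrancl_mono by blast+
      then have "(u, u) \<in> A\<^sup>+" by simp
      with in_M u show False by blast
    qed
    show "u = w" if uw: "u \<in> S - Domain M" "w \<in> S - Domain M" and p: "p \<in> P" "u \<in> set p" "w \<in> set p" for u w p
    proof (rule ccontr)
      assume "u \<noteq> w"
      have "set (vwalk_arcs p) \<subseteq> A"
        using p by (auto simp: A_def cover_arcs_def)
      then have "(u, w) \<in> A\<^sup>+ \<or> (w, u) \<in> A\<^sup>+"
        using vwalk_arcs_trancl_total[OF p(2,3) \<open>u \<noteq> w\<close>] trancl_mono by blast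
      with in_M uw show False by blast
    qed
  qed
  with \<open>balanced_matching G S M\<close> \<open>M \<subseteq> A\<close> show ?thesis
    by (auto simp: A_def)
qed

end

lemma matching_imp_cover:
  assumes D: "pair_fin_digraph D" and S: "S \<subseteq> pverts D" and M: "balanced_matching D S M"
  shows "\<exists>P C. path_cover D S P C \<and> cover_arcs P C = M \<and> card P + card (S \<inter> Domain M) = card S"
proof -
  interpret pair_fin_digraph D by fact
  \<comment> \<open>Vertices of \<open>S\<close> that \<open>M\<close> does not meet become
    one-vertex paths. By balance, \<open>W\<close> also contains the heads of all arcs of
    \<open>M\<close>.\<close>
  define W where "W = S \<union> Domain M"
  have M': "M \<subseteq> parcs D" "single_valued M" "single_valued (M\<inverse>)" "Domain M - S = Range M - S"
    using M by (auto simp: balanced_matching_def)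
  have "Field M \<subseteq> W" "W \<subseteq> pverts D"
    using M'(1,4) S by (auto simp: W_def Field_def dest: wellformed')
  then obtain P C where PC: "path_cover D W P C" "cover_arcs P C = M" "card P + card M = card W"
    using matching_decomposition[of M W] M' by blast
  have fin: "finite M" "finite S"
    using M'(1) S pair_finite_arcs pair_finite_verts finite_subset by blast+
  have "inj_on fst M"
    using M'(2) by (auto simp: inj_on_def single_valued_def)
  then have "card M = card (Domain M)"
    by (simp add: Domain_fst card_image)
  moreover have "card S + card (Domain M) = card W + card (S \<inter> Domain M)"
    unfolding W_def using fin by (intro card_Un_Int) (auto simp: finite_Domain)
  ultimately have "card P + card (S \<inter> Domain M) = card S"
    using PC(3) by linarith
  moreover have "path_cover D S P C"
    using PC(1) by (auto simp: path_cover_def W_def)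
  ultimately show ?thesis
    using PC(2) by blast
qed

section \<open>Equivalence of the two problems\<close>

text \<open>Only an inequality can be expected, since a cover may contain wasteful paths, for
  example one that misses \<open>S\<close>.\<close>

lemma flow_bound_of_cover:
  assumes "pair_fin_digraph D" and "S \<subseteq> pverts D" and "path_cover D S P C"
  shows "\<exists>f. network_flow D S f \<and> integral_on (network D S) f \<and> used_arcs D f \<subseteq> cover_arcs P C \<and>
    network_value D S f \<ge> real (card S) - real (card P)"
proof -
  interpret pair_fin_digraph D by fact
  obtain M where M: "balanced_matching D S M" "M \<subseteq> cover_arcs P C" "card (S - Domain M) \<le> card P"
    using cover_imp_matching[OF assms(3)] by blast
  have "finite S"
    using assms(2) pair_finite_verts finite_subset by blast
  then have "card S = card (S \<inter> Domain M) + card (S - Domain M)"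
    using card_Int_Diff by blast
  with M(3) have "real (card S) - real (card P) \<le> real (card (S \<inter> Domain M))"
    by linarith
  with M flow_of_matching[OF assms(1,2) M(1)] show ?thesis
    by metis
qed

lemma cover_of_flow:
  assumes "pair_fin_digraph D" and "S \<subseteq> pverts D"
    and "network_flow D S f" and "integral_on (network D S) f"
  shows "\<exists>P C. path_cover D S P C \<and> cover_arcs P C = used_arcs D f \<and>
    real (card P) = real (card S) - network_value D S f"
proof -
  note M = matching_of_flow[OF assms]
  obtain P C where PC: "path_cover D S P C" "cover_arcs P C = used_arcs D f"
      "card P + card (S \<inter> Domain (used_arcs D f)) = card S"
    using matching_imp_cover[OF assms(1,2) M(1)] by blast
  then have "real (card P) = real (card S) - network_value D S f"
    unfolding M(2) by linarith
  with PC show ?thesis by blast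
qed

lemma integral_network_flow:
  assumes "pair_fin_digraph D" and "S \<subseteq> pverts D" and "network_flow D S f"
  shows "\<exists>g. network_flow D S g \<and> integral_on (network D S) g \<and>
    used_arcs D g \<subseteq> used_arcs D f \<and> network_value D S f \<le> network_value D S g"
proof -
  have "integral_on (network D S) unit_cap"
    by (simp add: integral_on_def unit_cap_def)
  from integral_flow_in_support[OF pair_fin_digraph_network[OF assms(1,2)] _ _ _ this assms(3)]
  obtain g where "network_flow D S g" "integral_on (network D S) g"
      "\<forall>e\<in>parcs (network D S). 0 < g e \<longrightarrow> 0 < f e" "network_value D S f \<le> network_value D S g"
    by auto
  then show ?thesis
    by (intro exI[of _ g]) (auto simp: used_arcs_def network_def)
qed

theorem theorem3:
  fixes D :: "'v pair_pre_digraph" and S :: "'v set"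
  assumes "pair_fin_digraph D" and "S \<subseteq> pverts D"
  shows
    \<comment> \<open>feasible solutions: path covers yield flows, and flows yield path covers\<close>
    "(\<forall>P C. path_cover D S P C \<longrightarrow>
        (\<exists>f. network_flow D S f \<and> integral_on (network D S) f \<and>
             used_arcs D f \<subseteq> cover_arcs P C \<and>
             network_value D S f \<ge> real (card S) - real (card P))) \<and>
     (\<forall>f. network_flow D S f \<and> integral_on (network D S) f \<longrightarrow>
        (\<exists>P C. path_cover D S P C \<and> cover_arcs P C = used_arcs D f \<and>
               real (card P) = real (card S) - network_value D S f)) \<and>
    \<comment> \<open>both problems are solvable, and the flow optimum determines the minimum number of sources\<close>
     (\<exists>P. optimal_paths D S P) \<and>
     (\<exists>f. network_maxflow D S f \<and> integral_on (network D S) f) \<and>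
     (\<forall>P f. optimal_paths D S P \<and> network_maxflow D S f \<longrightarrow>
        real (num_sources P) = max (real (card S) - network_value D S f) 1) \<and>
    \<comment> \<open>every maximum flow, integral or not, yields an optimal path set\<close>
     (\<forall>f. network_maxflow D S f \<longrightarrow>
        (\<exists>P C. optimal_paths D S P \<and> path_cover D S P C \<and>
               cover_arcs P C \<subseteq> used_arcs D f \<and>
               real (card P) = real (card S) - network_value D S f)) \<and>
    \<comment> \<open>every optimal path set yields a maximum flow, except that a single path is also optimal
        when circles alone suffice, since then zero and one path have the same cost\<close>
     (\<forall>P C. optimal_paths D S P \<and> path_cover D S P C \<and>
            \<not> (card P = 1 \<and> (\<exists>C'. path_cover D S {} C')) \<longrightarrow>
        (\<exists>f. network_maxflow D S f \<and> integral_on (network D S) f \<and>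
             used_arcs D f \<subseteq> cover_arcs P C))"
proof -
  note cover_flow = flow_bound_of_cover[OF assms]
    and flow_cover = cover_of_flow[OF assms]
    and integral = integral_network_flow[OF assms]
  let ?feas = "\<lambda>P. \<exists>C. path_cover D S P C"
  have "network_flow D S (\<lambda>_. 0)" "integral_on (network D S) (\<lambda>_. 0)"
    by (auto simp: is_flow_def unit_cap_def integral_on_def)
  then have "\<exists>P. ?feas P"
    using flow_cover by blast
  \<comment> \<open>Minimising \<open>card\<close> instead of \<open>num_sources\<close>
    distinguishes zero paths from one path, as the flow value does.\<close>
  then obtain P0 where P0: "?feas P0" and P0_min: "\<And>P. ?feas P \<Longrightarrow> card P0 \<le> card P"
    using ex_has_least_nat[of ?feas _ card] by blast
  define m where "m = card P0"
  \<comment> \<open>A larger value would, after passing to an integral flow, yield a cover with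
    fewer than \<open>m\<close> paths.\<close>
  have value_le: "network_value D S f \<le> real (card S) - real m" if f: "network_flow D S f" for f
  proof -
    obtain g where g: "network_flow D S g" "integral_on (network D S) g"
        "network_value D S f \<le> network_value D S g"
      using integral[OF f] by blast
    then obtain P C where "path_cover D S P C" "real (card P) = real (card S) - network_value D S g"
      using flow_cover by blast
    then show ?thesis
      using P0_min[of P] g(3) by (force simp: m_def)
  qed
  obtain f0 where f0: "network_flow D S f0" "integral_on (network D S) f0"
      "network_value D S f0 \<ge> real (card S) - real m"
    using cover_flow P0 unfolding m_def by blast
  have maxflow_iff: "network_maxflow D S f \<longleftrightarrow>
      network_flow D S f \<and> network_value D S f = real (card S) - real m" for f
    using value_le[of f] value_le[of f0] value_le f0(1,3)
    unfolding is_maxflow_def is_arg_max_def by (smt (verit))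
  \<comment> \<open>For \<open>m = 0\<close> this also admits path sets of size one, the source of
    the exception in the last claim.\<close>
  have optimal_iff: "optimal_paths D S P \<longleftrightarrow> ?feas P \<and> num_sources P = max m 1" for P
  proof -
    have ge: "max m 1 \<le> num_sources Q" if "?feas Q" for Q
      using P0_min[OF that] by (auto simp: num_sources_def m_def)
    moreover have "num_sources P0 = max m 1"
      by (simp add: num_sources_def m_def)
    ultimately show ?thesis
      using P0 unfolding optimal_paths_def is_arg_min_def by (metis le_antisym linorder_not_less)
  qed
  have "\<exists>P. optimal_paths D S P"
    using P0 by (auto simp: optimal_iff num_sources_def m_def)
  moreover have "\<exists>f. network_maxflow D S f \<and> integral_on (network D S) f"
    using f0 value_le[OF f0(1)] by (auto simp: maxflow_iff)
  moreover have "real (num_sources P) = max (real (card S) - network_value D S f) 1"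
    if "optimal_paths D S P" "network_maxflow D S f" for P f
    using that by (simp add: optimal_iff maxflow_iff of_nat_max)
  moreover have "\<exists>P C. optimal_paths D S P \<and> path_cover D S P C \<and> cover_arcs P C \<subseteq> used_arcs D f \<and>
      real (card P) = real (card S) - network_value D S f" if "network_maxflow D S f" for f
  proof -
    have f: "network_flow D S f" "network_value D S f = real (card S) - real m"
      using that by (auto simp: maxflow_iff)
    then obtain g where g: "network_flow D S g" "integral_on (network D S) g"
        "used_arcs D g \<subseteq> used_arcs D f" "network_value D S f \<le> network_value D S g"
      using integral by blast
    then have "network_value D S g = real (card S) - real m"
      using value_le[of g] f(2) by simp
    then obtain P C where "path_cover D S P C" "cover_arcs P C = used_arcs D g" "card P = m"
      using flow_cover[OF g(1,2)] by auto
    with g(3) f(2) show ?thesis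
      by (intro exI[of _ P] exI[of _ C]) (auto simp: optimal_iff num_sources_def)
  qed
  moreover have "\<exists>f. network_maxflow D S f \<and> integral_on (network D S) f \<and>
      used_arcs D f \<subseteq> cover_arcs P C"
    if P: "optimal_paths D S P" "path_cover D S P C"
      and not_single: "\<not> (card P = 1 \<and> (\<exists>C'. path_cover D S {} C'))" for P C
  proof -
    have "max (card P) 1 = max m 1"
      using P(1) by (auto simp: optimal_iff num_sources_def)
    \<comment> \<open>If \<open>m = 0\<close>, then \<open>P0\<close> is empty, so circles alone
      cover \<open>S\<close> and the hypothesis excludes a single path.\<close>
    moreover have "card P \<noteq> 1" if "m = 0"
    proof -
      have "finite P0"
        using P0 by (auto simp: path_cover_def)
      with that have "P0 = {}"
        by (simp add: m_def)
      with P0 not_single show ?thesis by auto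
    qed
    ultimately have "card P \<le> m"
      by (cases "m = 0") (auto simp: max_def split: if_splits)
    obtain f where "network_flow D S f" "integral_on (network D S) f"
        "used_arcs D f \<subseteq> cover_arcs P C" "network_value D S f \<ge> real (card S) - real (card P)"
      using cover_flow[OF P(2)] by blast
    then show ?thesis
      using value_le[of f] \<open>card P \<le> m\<close> by (intro exI[of _ f]) (auto simp: maxflow_iff)
  qed
  ultimately show ?thesis
    using cover_flow flow_cover by blast
qed

end
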